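(* Let $G=(V,E)$ be a finite loopless directed graph without parallel edges and let $\Pi^*=\Pi_{\mathrm{opp}}(G)$. Suppose that an edge partition $\Pi$ of $E$ places every opposite pair from every directed two-step diamond pattern of $G$ in a common block. Then $\Pi$ is a coarsening of $\Pi^*$ (every block of $\Pi^*$ is contained in a block of $\Pi$). If moreover $\Pi$ and $\Pi^*$ have the same number of blocks, then $\Pi=\Pi^*$.
   Context: An edge partition is an unlabelled collection of nonempty pairwise disjoint subsets (blocks) of $E$ with union $E$. A directed two-step diamond pattern is a quadruple of distinct vertices $(x,a,b,y)$ with $(x,a),(x,b),(a,y),(b,y)\in E$ (additional arcs among the four vertices are allowed). Its two opposite pairs are $\{(x,a),(b,y)\}$ and $\{(x,b),(a,y)\}$. $\Omega(G)$ is the undirected graph with vertex set $E$ in which two directed edges are joined whenever they form an opposite pair of some such pattern. The opposite-diamond partition $\Pi_{\mathrm{opp}}(G)$ is the set of connected components of $\Omega(G)$. *)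

theory Defs
  imports "Graph_Theory.Digraph_Component" "HOL-Library.Disjoint_Sets"
begin

definition diamond_pattern :: "'a pair_pre_digraph \<Rightarrow> 'a \<Rightarrow> 'a \<Rightarrow> 'a \<Rightarrow> 'a \<Rightarrow> bool" where
  "diamond_pattern G x a b y \<longleftrightarrow>
     distinct [x, a, b, y] \<and>
     (x, a) \<in> parcs G \<and> (x, b) \<in> parcs G \<and> (a, y) \<in> parcs G \<and> (b, y) \<in> parcs G"

definition opposite_pairs :: "'a pair_pre_digraph \<Rightarrow> ('a \<times> 'a) set set" where
  "opposite_pairs G =
     {p. \<exists>x a b y. diamond_pattern G x a b y \<and>
           (p = {(x, a), (b, y)} \<or> p = {(x, b), (a, y)})}"

text \<open>The undirected graph \<open>\<Omega>(G)\<close> on the arcs of \<open>G\<close>. As usual in the digraph library, an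
  undirected graph is a symmetric digraph (see \<open>pair_graph_opposite_graph\<close>), so
  its connected components are its strongly connected components, given here by their vertex sets.\<close>

definition opposite_graph :: "'a pair_pre_digraph \<Rightarrow> ('a \<times> 'a) pair_pre_digraph" where
  "opposite_graph G = \<lparr> pverts = parcs G, parcs = {(e, f). {e, f} \<in> opposite_pairs G} \<rparr>"

definition opposite_partition :: "'a pair_pre_digraph \<Rightarrow> ('a \<times> 'a) set set" where
  "opposite_partition G = pre_digraph.sccs_verts (with_proj (opposite_graph G))"

lemma pair_graph_opposite_graph:
  assumes "pair_digraph G"
  shows "pair_graph (opposite_graph G)"
proof -
  interpret pair_digraph G by fact
  have sub: "parcs (opposite_graph G) \<subseteq> parcs G \<times> parcs G"
    by (auto simp: opposite_graph_def opposite_pairs_def diamond_pattern_def doubleton_eq_iff)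
  have fin: "finite (parcs (opposite_graph G))"
    using sub by (rule finite_subset) (simp add: pair_finite_arcs)
  have irr: "fst e \<noteq> snd e" if "e \<in> parcs (opposite_graph G)" for e
    using that
    by (cases e)
      (auto simp: opposite_graph_def opposite_pairs_def diamond_pattern_def doubleton_eq_iff)
  have "sym (parcs (opposite_graph G))"
    by (auto simp: opposite_graph_def sym_def insert_commute)
  then have sm: "symmetric (with_proj (opposite_graph G))"
    by (simp add: symmetric_def)
  have v: "pverts (opposite_graph G) = parcs G"
    by (simp add: opposite_graph_def)
  show ?thesis
    by unfold_locales (use sub fin irr sm v pair_finite_arcs in auto)
qed

end

theory Submission
  imports Defs
begin

text \<open>Blocks of a partition are closed under adjacency in the graph \<open>\<Omega>(G)\<close> as soon as they absorb
  opposite pairs, hence closed under reachability, which gives the coarsening. Mapping each block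
  of the finer partition to the block containing it is a surjection; if there are finitely many
  and equally many blocks it is a bijection, so no block of the coarser partition is a union of
  two blocks of the finer one.\<close>

lemma refines_card_eq_imp_eq:
  assumes ref: "refines A P Q" and "finite P" and "card Q = card P"
  shows "Q = P"
proof -
  have P: "partition_on A P" and Q: "partition_on A Q"
    using ref by (auto simp: refines_def)
  obtain f where f: "f X \<in> Q" "X \<subseteq> f X" if "X \<in> P" for X
    using ref unfolding refines_def by metis
  \<comment> \<open>Since \<open>X\<close> lies inside \<open>f X\<close>, both \<open>f X\<close>
    and \<open>Y\<close> are blocks of \<open>Q\<close> containing \<open>x\<close>, so disjointness
    identifies them.\<close>
  have f_eq: "f X = Y" if "X \<in> P" "Y \<in> Q" "x \<in> X" "x \<in> Y" for X Y x
    using partition_onD2[OF Q] f[OF \<open>X \<in> P\<close>] that unfolding disjoint_def by blast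
  have cover: "\<exists>X\<in>P. x \<in> X" if "x \<in> Y" "Y \<in> Q" for x Y
    using partition_onD1[OF P] partition_onD1[OF Q] that by blast
  have image: "f ` P = Q"
  proof
    show "f ` P \<subseteq> Q" using f by blast
    show "Q \<subseteq> f ` P"
    proof
      fix Y assume Y: "Y \<in> Q"
      then obtain y where y: "y \<in> Y" using partition_onD3[OF Q] by fastforce
      with Y obtain X where "X \<in> P" "y \<in> X" using cover by blast
      with y Y show "Y \<in> f ` P" using f_eq by blast
    qed
  qed
  with assms have inj: "inj_on f P"
    by (intro eq_card_imp_inj_on) auto
  \<comment> \<open>A block \<open>X'\<close> of \<open>P\<close> through a point of
    \<open>f X\<close> is also sent to \<open>f X\<close>; injectivity then forces
    \<open>X' = X\<close>.\<close>
  have "f X = X" if X: "X \<in> P" for X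
  proof
    show "f X \<subseteq> X"
    proof
      fix y assume y: "y \<in> f X"
      then obtain X' where X': "X' \<in> P" "y \<in> X'" using cover f X by blast
      then have "f X' = f X" using f_eq f X y by blast
      then have "X' = X" using inj X X' by (simp add: inj_on_eq_iff)
      with X' show "y \<in> X" by simp
    qed
  qed (use f X in blast)
  then show ?thesis using image by auto
qed

lemma (in wf_digraph) partition_on_sccs_verts: "partition_on (verts G) sccs_verts"
proof (rule partition_onI)
  show "\<Union>sccs_verts = verts G"
    using sccs_verts_subsets scc_of_in_sccs_verts in_scc_of_self by blast
  show "disjnt S T" if "S \<in> sccs_verts" "T \<in> sccs_verts" "S \<noteq> T" for S T
    using sccs_verts_disjoint that by (simp add: disjnt_def)
  show "{} \<notin> sccs_verts" by (simp add: in_sccs_verts_conv_reachable)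
qed

text \<open>By induction along walks, the block of \<open>P\<close> containing \<open>u\<close>
  contains everything reachable from \<open>u\<close>, in particular the whole strong component of
  \<open>u\<close>.\<close>

lemma (in wf_digraph) refines_sccs_verts:
  assumes P: "partition_on (verts G) P"
    and adj: "\<And>u v. u \<rightarrow>\<^bsub>G\<^esub> v \<Longrightarrow> \<exists>B\<in>P. {u, v} \<subseteq> B"
  shows "refines (verts G) sccs_verts P"
  unfolding refines_def
proof (intro conjI ballI partition_on_sccs_verts P)
  fix S assume S: "S \<in> sccs_verts"
  then obtain u where u: "u \<in> S" by (auto simp: in_sccs_verts_conv_reachable)
  with S obtain B where B: "B \<in> P" "u \<in> B"
    using sccs_verts_subsets partition_onD1[OF P] by blast
  have "v \<in> B" if "u \<rightarrow>\<^sup>* v" for v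
    using that
  proof (induct rule: reachable_induct)
    case base
    show ?case by fact
  next
    case (step x y)
    then obtain C where "C \<in> P" "{x, y} \<subseteq> C" using adj by blast
    \<comment> \<open>The blocks \<open>B\<close> and \<open>C\<close> share \<open>x\<close>, hence
      coincide, so \<open>y\<close> lies in \<open>B\<close>.\<close>
    with step B show ?case using partition_onD2[OF P] unfolding disjoint_def by blast
  qed
  with S u have "S \<subseteq> B" by (auto simp: in_sccs_verts_conv_reachable)
  with B show "\<exists>B\<in>P. S \<subseteq> B" by blast
qed

theorem theorem3p2:
  fixes G :: "'a pair_pre_digraph" and P :: "('a \<times> 'a) set set"
  assumes "pair_digraph G"
    and "partition_on (parcs G) P"
    and "\<forall>p \<in> opposite_pairs G. \<exists>B \<in> P. p \<subseteq> B"
  shows "refines (parcs G) (opposite_partition G) P \<and>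
         (card P = card (opposite_partition G) \<longrightarrow> P = opposite_partition G)"
proof -
  interpret \<Omega>: pair_graph "opposite_graph G"
    using assms(1) by (rule pair_graph_opposite_graph)
  have verts: "pverts (opposite_graph G) = parcs G"
    by (simp add: opposite_graph_def)
  have adj: "\<exists>B\<in>P. {e, f} \<subseteq> B" if "(e, f) \<in> parcs (opposite_graph G)" for e f
  proof -
    from that have "{e, f} \<in> opposite_pairs G" by (simp add: opposite_graph_def)
    with assms(3) show ?thesis by (rule bspec)
  qed
  have "refines (parcs G) (opposite_partition G) P"
    using \<Omega>.refines_sccs_verts[of P] adj assms(2) by (simp add: verts opposite_partition_def)
  \<comment> \<open>Finiteness gives the equation of cardinalities its meaning, as
    \<open>card\<close> is 0 on infinite sets.\<close>
  moreover have "finite (opposite_partition G)"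
    unfolding opposite_partition_def by (rule \<Omega>.finite_sccs_verts)
  ultimately show ?thesis
    using refines_card_eq_imp_eq by blast
qed

end
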